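(* Let $\alpha$ be a positive real root of the $(2,1)$ entry of a matrix in the image of the Burau representation of $B_3$ that is not in $\langle\sigma_1\rangle$. Then $\alpha\in\left(\frac{3-\sqrt5}{2},\frac{3+\sqrt5}{2}\right)$, and specializing $t=\alpha$ is an unfaithful specialization of the Burau representation.
   Context: $B_3$ is the braid group on three strands with standard generators $\sigma_1,\sigma_2$. The Burau representation of $B_3$ is the homomorphism $\rho_3:B_3\to GL_2(\mathbb{Z}[t,t^{-1}])$ with $\rho_3(\sigma_1)=\begin{pmatrix}-t&1\\0&1\end{pmatrix}$, $\rho_3(\sigma_2)=\begin{pmatrix}1&0\\t&-t\end{pmatrix}$. A matrix in the image is said to be not in $\langle\sigma_1\rangle$ if it is $\rho_3(w)$ for a braid $w\in B_3$ that is not a power of $\sigma_1$. The entries of such matrices are integral polynomials in $t$ and $t^{-1}$. For a nonzero real number $t_0$, the specialization at $t_0$ is the composition of $\rho_3$ with the evaluation map $GL_2(\mathbb{Z}[t,t^{-1}])\to GL_2(\mathbb{R})$, $t\mapsto t_0$; it is unfaithful if it is not injective.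
   Formalization: The (2,1) entry is also required to be a nonzero Laurent polynomial: the braid (σ₁σ₂σ₁)² is not a power of σ₁, but its image is a scalar matrix with (2,1) entry 0, so every positive real would count as a root and the claim would fail. *)

theory Defs
  imports
    "HOL-Analysis.Analysis"
    "HOL-Library.Poly_Mapping"
    "HOL-Algebra.Generated_Groups"
begin

section \<open>The braid group on three strands\<close>

datatype generator = Sigma1 | Sigma2

text \<open>The letter \<open>(s, True)\<close> stands for \<open>s\<close> and \<open>(s, False)\<close> for its formal inverse.\<close>

type_synonym braid_word = "(generator \<times> bool) list"

inductive braid_equiv :: "braid_word \<Rightarrow> braid_word \<Rightarrow> bool" where
  refl: "braid_equiv u u"
| sym: "braid_equiv u v \<Longrightarrow> braid_equiv v u"
| trans: "braid_equiv u v \<Longrightarrow> braid_equiv v w \<Longrightarrow> braid_equiv u w"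
| append: "braid_equiv u u' \<Longrightarrow> braid_equiv v v' \<Longrightarrow> braid_equiv (u @ v) (u' @ v')"
| cancel: "braid_equiv [(s, b), (s, \<not> b)] []"
| braid: "braid_equiv [(Sigma1, True), (Sigma2, True), (Sigma1, True)]
                      [(Sigma2, True), (Sigma1, True), (Sigma2, True)]"

quotient_type braid3 = braid_word / braid_equiv
  by (intro equivpI reflpI sympI transpI)
     (auto intro: braid_equiv.refl braid_equiv.sym braid_equiv.trans)

lift_definition braid_one :: braid3 is "[]" .

lift_definition braid_mult :: "braid3 \<Rightarrow> braid3 \<Rightarrow> braid3" is "(@)"
  by (rule braid_equiv.append)

lift_definition braid_gen :: "generator \<Rightarrow> braid3" is "\<lambda>s. [(s, True)]" .

definition B3 :: "braid3 monoid" where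
  "B3 = \<lparr>carrier = UNIV, mult = braid_mult, one = braid_one\<rparr>"

lemma B3_simps [simp]:
  "carrier B3 = UNIV" "x \<otimes>\<^bsub>B3\<^esub> y = braid_mult x y" "\<one>\<^bsub>B3\<^esub> = braid_one"
  by (simp_all add: B3_def)

lemma braid_equiv_inverse: "braid_equiv (map (\<lambda>(s, b). (s, \<not> b)) (rev w) @ w) []"
proof (induction w)
  case Nil
  show ?case by (simp add: braid_equiv.refl)
next
  case (Cons l w)
  obtain s b where l: "l = (s, b)" by (cases l)
  let ?v = "map (\<lambda>(s, b). (s, \<not> b)) (rev w)"
  have "braid_equiv ([(s, \<not> b), (s, b)] @ w) ([] @ w)"
    using braid_equiv.append[OF braid_equiv.cancel[of s "\<not> b"] braid_equiv.refl[of w]] by simp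
  from braid_equiv.append[OF braid_equiv.refl[of ?v] this]
  have "braid_equiv (?v @ [(s, \<not> b), (s, b)] @ w) (?v @ w)" by simp
  then show ?case using Cons.IH braid_equiv.trans by (fastforce simp: l)
qed

lemma group_B3: "group B3"
proof (rule groupI)
  fix x y z :: braid3
  show "(x \<otimes>\<^bsub>B3\<^esub> y) \<otimes>\<^bsub>B3\<^esub> z = x \<otimes>\<^bsub>B3\<^esub> (y \<otimes>\<^bsub>B3\<^esub> z)"
    by simp (transfer, simp add: braid_equiv.refl)
  show "\<one>\<^bsub>B3\<^esub> \<otimes>\<^bsub>B3\<^esub> x = x"
    by simp (transfer, simp add: braid_equiv.refl)
  have "\<exists>y. braid_mult y x = braid_one"
    by transfer (blast intro: braid_equiv_inverse)
  then show "\<exists>y\<in>carrier B3. y \<otimes>\<^bsub>B3\<^esub> x = \<one>\<^bsub>B3\<^esub>" by simp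
qed simp_all

lemma B3_braid_relation:
  "braid_gen Sigma1 \<otimes>\<^bsub>B3\<^esub> braid_gen Sigma2 \<otimes>\<^bsub>B3\<^esub> braid_gen Sigma1 =
   braid_gen Sigma2 \<otimes>\<^bsub>B3\<^esub> braid_gen Sigma1 \<otimes>\<^bsub>B3\<^esub> braid_gen Sigma2"
  by simp (transfer, simp add: braid_equiv.braid)

text \<open>The value of a word in a group \<open>G\<close> under an assignment of the generators.\<close>

fun word_value :: "('g, 'm) monoid_scheme \<Rightarrow> (generator \<Rightarrow> 'g) \<Rightarrow> braid_word \<Rightarrow> 'g" where
  "word_value G f [] = \<one>\<^bsub>G\<^esub>"
| "word_value G f ((s, b) # w) =
     (if b then f s else inv\<^bsub>G\<^esub> (f s)) \<otimes>\<^bsub>G\<^esub> word_value G f w"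

context group
begin

lemma word_value_closed:
  assumes "\<And>s. f s \<in> carrier G"
  shows "word_value G f w \<in> carrier G"
  using assms by (induction w) auto

lemma word_value_append:
  assumes "\<And>s. f s \<in> carrier G"
  shows "word_value G f (u @ v) = word_value G f u \<otimes> word_value G f v"
proof (induction u)
  case (Cons l u)
  obtain s b where "l = (s, b)" by (cases l)
  then show ?case
    using Cons assms word_value_closed[of f, OF assms] by (auto simp: m_assoc)
qed (simp add: word_value_closed assms)

lemma word_value_cong:
  assumes f: "\<And>s. f s \<in> carrier G"
    and br: "f Sigma1 \<otimes> f Sigma2 \<otimes> f Sigma1 = f Sigma2 \<otimes> f Sigma1 \<otimes> f Sigma2"
    and "braid_equiv u v"
  shows "word_value G f u = word_value G f v"
  using assms(3)
proof induction
  case (cancel s b)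
  then show ?case using f by (cases b) auto
next
  case braid
  then show ?case using f br by (simp add: m_assoc)
qed (simp_all add: word_value_append f)

end


section \<open>Laurent polynomials and matrices\<close>

text \<open>
  The ring of integral Laurent polynomials is the group ring of the additive group of integers:
  finitely supported functions on the exponents, multiplied by convolution.
\<close>

type_synonym laurent = "int \<Rightarrow>\<^sub>0 int"

definition indet :: laurent where
  "indet = Poly_Mapping.single 1 1"

definition laurent_eval :: "real \<Rightarrow> laurent \<Rightarrow> real" where
  "laurent_eval t p = (\<Sum>k\<in>Poly_Mapping.keys p. of_int (Poly_Mapping.lookup p k) * t powi k)"

lemma laurent_eval_zero [simp]: "laurent_eval t 0 = 0"
  by (simp add: laurent_eval_def)

lemma laurent_eval_single: "laurent_eval t (Poly_Mapping.single k c) = of_int c * t powi k"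
  by (simp add: laurent_eval_def)

lemma laurent_eval_one [simp]: "laurent_eval t 1 = 1"
  using laurent_eval_single[of t 0 1] by simp

lemma laurent_eval_indet [simp]: "laurent_eval t indet = t"
  by (simp add: indet_def laurent_eval_single)

lemma laurent_eval_add [simp]: "laurent_eval t (p + q) = laurent_eval t p + laurent_eval t q"
  unfolding laurent_eval_def
  by (rule setsum_keys_plus_distrib) (simp_all add: distrib_right)

lemma laurent_eval_minus [simp]: "laurent_eval t (- p) = - laurent_eval t p"
  using laurent_eval_add[of t p "- p"] by simp

lemma laurent_induct [case_names zero single add]:
  assumes "P 0" and "\<And>k c. P (Poly_Mapping.single k c)"
    and "\<And>p q. P p \<Longrightarrow> P q \<Longrightarrow> P (p + q)"
  shows "P (p :: laurent)"
proof -
  have "P (\<Sum>k\<in>A. Poly_Mapping.single k (Poly_Mapping.lookup p k))" if "finite A" for A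
    using that assms by (induction A) auto
  moreover have "(\<Sum>k\<in>Poly_Mapping.keys p. Poly_Mapping.single k (Poly_Mapping.lookup p k)) = p"
    by (rule poly_mapping_eqI)
       (simp add: lookup_sum lookup_single when_def sum.delta in_keys_iff)
  ultimately show ?thesis by (metis finite_keys)
qed

lemma laurent_eval_mult [simp]:
  assumes "t \<noteq> 0"
  shows "laurent_eval t (p * q) = laurent_eval t p * laurent_eval t q"
proof (induction p rule: laurent_induct)
  case (single k c)
  show ?case
  proof (induction q rule: laurent_induct)
    case (single l d)
    then show ?case using assms by (simp add: mult_single laurent_eval_single power_int_add)
  qed (simp_all add: distrib_left)
qed (simp_all add: distrib_right)

definition GL2 :: "('a::comm_ring_1 ^ 2 ^ 2) monoid" where
  "GL2 = \<lparr>carrier = {A. invertible A}, mult = (**), one = mat 1\<rparr>"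

lemma GL2_simps [simp]:
  "carrier GL2 = {A. invertible A}" "A \<otimes>\<^bsub>GL2\<^esub> B = A ** B" "\<one>\<^bsub>GL2\<^esub> = mat 1"
  by (simp_all add: GL2_def)

lemma group_GL2: "group (GL2 :: ('a::comm_ring_1 ^ 2 ^ 2) monoid)"
proof (rule groupI)
  fix A :: "'a ^ 2 ^ 2"
  assume "A \<in> carrier GL2"
  then obtain B where "A ** B = mat 1" "B ** A = mat 1"
    by (auto simp: invertible_def)
  then show "\<exists>B\<in>carrier GL2. B \<otimes>\<^bsub>GL2\<^esub> A = \<one>\<^bsub>GL2\<^esub>"
    by (auto simp: invertible_def)
next
  fix A B :: "'a ^ 2 ^ 2"
  assume "A \<in> carrier GL2" "B \<in> carrier GL2"
  then obtain A' B' where "A ** A' = mat 1" "A' ** A = mat 1" "B ** B' = mat 1" "B' ** B = mat 1"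
    by (auto simp: invertible_def)
  then have "(A ** B) ** (B' ** A') = mat 1" "(B' ** A') ** (A ** B) = mat 1"
    by (metis matrix_mul_assoc matrix_mul_rid)+
  then show "A \<otimes>\<^bsub>GL2\<^esub> B \<in> carrier GL2"
    by (auto simp: invertible_def)
qed (auto simp: matrix_mul_assoc invertible_def intro!: exI[of _ "mat 1"])

lemma map_matrix_laurent_eval_mult:
  fixes A B :: "laurent ^ 2 ^ 2"
  assumes "t \<noteq> 0"
  shows "map_matrix (laurent_eval t) (A ** B) =
         map_matrix (laurent_eval t) A ** map_matrix (laurent_eval t) B"
  using assms by (simp add: vec_eq_iff matrix_matrix_mult_def sum_2)

lemma map_matrix_laurent_eval_one: "map_matrix (laurent_eval t) (mat 1 :: laurent ^ 2 ^ 2) = mat 1"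
  by (simp add: vec_eq_iff mat_def)


section \<open>The Burau representation and its specializations\<close>

fun burau_generator :: "generator \<Rightarrow> laurent ^ 2 ^ 2" where
  "burau_generator Sigma1 = vector [vector [- indet, 1], vector [0, 1]]"
| "burau_generator Sigma2 = vector [vector [1, 0], vector [indet, - indet]]"

lemma indet_inverse: "indet * Poly_Mapping.single (- 1) 1 = 1" "Poly_Mapping.single (- 1) 1 * indet = 1"
  by (simp_all add: indet_def mult_single)

lemma burau_generator_invertible: "invertible (burau_generator s)"
proof -
  let ?U = "Poly_Mapping.single (- 1) 1 :: laurent"
  define B :: "laurent ^ 2 ^ 2" where
    "B = (if s = Sigma1 then vector [vector [- ?U, ?U], vector [0, 1]]
          else vector [vector [1, 0], vector [1, - ?U]])"
  have "burau_generator s ** B = mat 1" "B ** burau_generator s = mat 1"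
    by (cases s; simp add: B_def vec_eq_iff forall_2 matrix_matrix_mult_def sum_2 mat_def indet_inverse)+
  then show ?thesis unfolding invertible_def by blast
qed

lemma burau_generator_braid:
  "burau_generator Sigma1 ** burau_generator Sigma2 ** burau_generator Sigma1 =
   burau_generator Sigma2 ** burau_generator Sigma1 ** burau_generator Sigma2"
  by (simp add: vec_eq_iff forall_2 matrix_matrix_mult_def sum_2 algebra_simps)

lift_definition burau :: "braid3 \<Rightarrow> laurent ^ 2 ^ 2" is "word_value GL2 burau_generator"
  by (rule group.word_value_cong[OF group_GL2])
     (simp_all add: burau_generator_invertible burau_generator_braid del: burau_generator.simps)

lemma burau_braid_gen: "burau (braid_gen s) = burau_generator s"
  by transfer (simp add: matrix_mul_rid)

lemma burau_hom: "burau \<in> hom B3 GL2"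
proof (rule homI)
  fix x y :: braid3
  show "burau x \<in> carrier GL2"
    by transfer (rule group.word_value_closed[OF group_GL2], simp add: burau_generator_invertible)
  have "burau (braid_mult x y) = burau x \<otimes>\<^bsub>GL2\<^esub> burau y"
    by transfer
       (rule group.word_value_append[OF group_GL2], simp add: burau_generator_invertible)
  then show "burau (x \<otimes>\<^bsub>B3\<^esub> y) = burau x \<otimes>\<^bsub>GL2\<^esub> burau y" by simp
qed

definition burau_specialization :: "real \<Rightarrow> braid3 \<Rightarrow> real ^ 2 ^ 2" where
  "burau_specialization t = map_matrix (laurent_eval t) \<circ> burau"

lemma burau_specialization_hom:
  assumes "t \<noteq> 0"
  shows "burau_specialization t \<in> hom B3 GL2"
proof (rule homI)
  fix x y :: braid3
  have "invertible (burau x)" using burau_hom by (auto simp: hom_def)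
  then show "burau_specialization t x \<in> carrier GL2"
    using assms
    by (auto simp: invertible_def burau_specialization_def
          simp flip: map_matrix_laurent_eval_mult map_matrix_laurent_eval_one)
       (metis map_matrix_laurent_eval_mult map_matrix_laurent_eval_one)
  show "burau_specialization t (x \<otimes>\<^bsub>B3\<^esub> y) =
        burau_specialization t x \<otimes>\<^bsub>GL2\<^esub> burau_specialization t y"
    using hom_mult[OF burau_hom, of x y] assms
    by (simp add: burau_specialization_def map_matrix_laurent_eval_mult)
qed

definition unfaithful_specialization :: "real \<Rightarrow> bool" where
  "unfaithful_specialization t \<longleftrightarrow> \<not> inj_on (burau_specialization t) (carrier B3)"

text \<open>As usual, a number is called a root of a Laurent polynomial only if the latter is nonzero.
  This matters for matrix entries: the square of the Garside element \<open>\<sigma>\<^sub>1 \<sigma>\<^sub>2 \<sigma>\<^sub>1\<close> is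
  mapped to a scalar matrix, but it is not a power of \<open>\<sigma>\<^sub>1\<close>.\<close>

definition laurent_root :: "real \<Rightarrow> laurent \<Rightarrow> bool" where
  "laurent_root t p \<longleftrightarrow> p \<noteq> 0 \<and> laurent_eval t p = 0"

end

theory Submission
  imports Defs
begin

text \<open>
  Modulo scalars the image of the Burau representation is generated by
  \<open>z \<mapsto> 1 / (t z)\<close> (from \<open>\<sigma>\<^sub>1 \<sigma>\<^sub>2 \<sigma>\<^sub>1\<close>) and the rotation \<open>z \<mapsto> 1 / (1 - z)\<close> of order three (from
  \<open>\<sigma>\<^sub>1 \<sigma>\<^sub>2\<close>), and the \<open>(2,1)\<close> entry vanishes iff \<open>\<infinity>\<close> is fixed. If \<open>t + 1 / t \<ge> 3\<close>, a ping-pong argument on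
  the real projective line shows that the orbit of \<open>\<infinity>\<close> returns to \<open>\<infinity>\<close> only where it does so for
  generic \<open>t\<close>. This bounds the roots.

  At a root \<open>\<alpha>\<close> of the entry of \<open>\<rho>(g)\<close>, both \<open>\<rho>(g)\<close> and \<open>\<rho>(\<sigma>\<^sub>1)\<close> become upper triangular. Hence
  \<open>h = g\<inverse> \<sigma>\<^sub>1 g\<close> and \<open>\<sigma>\<^sub>1\<close> have the same diagonal, and the unipotent matrices of \<open>h \<sigma>\<^sub>1\<inverse>\<close> and
  \<open>\<sigma>\<^sub>1\<inverse> h\<close> commute. If the specialization were faithful, they would commute in \<open>B\<^sub>3\<close>, so that over the
  Laurent polynomials \<open>h\<close> and \<open>\<sigma>\<^sub>1\<close> would share one of the eigenlines of \<open>\<sigma>\<^sub>1\<close>, spanned by \<open>(1, 0)\<close> and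
  \<open>(1, 1 + t)\<close>. The invariant sesquilinear form of Squier excludes this unless the entry is zero.
\<close>

section \<open>The orbit of the point at infinity\<close>

text \<open>
  Pairs \<open>(x, y)\<close> are homogeneous coordinates of \<open>z = x / y\<close>. The rotation \<open>b\<close> permutes \<open>\<infinity>, 0, 1\<close>
  and \<open>a : z \<mapsto> 1 / (t z)\<close> swaps \<open>\<infinity>\<close> and \<open>0\<close>, so the orbit leaves this triple only through \<open>a(1) = 1 / t\<close>.
  The inductive rules close \<open>{1 / t}\<close> under \<open>a b\<close> and \<open>a b\<inverse>\<close>.
\<close>

inductive orbit_tail :: "laurent \<Rightarrow> laurent \<Rightarrow> bool" where
  base: "x dvd 1 \<Longrightarrow> orbit_tail x (indet * x)"
| rot: "orbit_tail x y \<Longrightarrow> orbit_tail (y - x) (indet * y)"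
| rot_inv: "orbit_tail x y \<Longrightarrow> orbit_tail x (indet * (x - y))"
| scale: "c dvd 1 \<Longrightarrow> orbit_tail x y \<Longrightarrow> orbit_tail (c * x) (c * y)"

text \<open>The last two disjuncts are the rotations of the tail by \<open>b\<close> and its
  inverse. Scalars are units, so they stay nonzero at every nonzero \<open>t\<close>.\<close>

definition orbit :: "laurent \<Rightarrow> laurent \<Rightarrow> bool" where
  "orbit x y \<longleftrightarrow> (y = 0 \<and> x dvd 1) \<or> (x = 0 \<and> y dvd 1) \<or> (x = y \<and> x dvd 1) \<or>
     orbit_tail x y \<or> orbit_tail (x - y) x \<or> orbit_tail y (y - x)"

lemma indet_unit: "indet dvd 1" "Poly_Mapping.single (- 1) 1 dvd (1::laurent)"
  by (metis indet_inverse dvd_triv_left)+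

lemma orbitI:
  "orbit_tail x y \<Longrightarrow> orbit x y"
  "orbit_tail (x - y) x \<Longrightarrow> orbit x y"
  "orbit_tail y (y - x) \<Longrightarrow> orbit x y"
  "x dvd 1 \<Longrightarrow> orbit x 0" "y dvd 1 \<Longrightarrow> orbit 0 y" "x dvd 1 \<Longrightarrow> orbit x x"
  by (simp_all add: orbit_def)

lemma orbit_cases:
  assumes "orbit x y"
  obtains "y = 0" "x dvd 1" | "x = 0" "y dvd 1" | "x = y" "y dvd 1" | "orbit_tail x y"
    | "orbit_tail (x - y) x" | "orbit_tail y (y - x)"
  using assms unfolding orbit_def by blast

lemma unit_mult: "c dvd 1 \<Longrightarrow> x dvd 1 \<Longrightarrow> c * x dvd (1 :: laurent)"
  using mult_dvd_mono[of c 1 x 1] by simp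

lemma orbit_scale:
  assumes "c dvd 1" "orbit x y"
  shows "orbit (c * x) (c * y)"
  using assms(2)
proof (cases rule: orbit_cases)
  case 5
  then have "orbit_tail (c * (x - y)) (c * x)" by (intro orbit_tail.scale assms(1))
  then show ?thesis by (intro orbitI(2)) (simp only: right_diff_distrib)
next
  case 6
  then have "orbit_tail (c * y) (c * (y - x))" by (intro orbit_tail.scale assms(1))
  then show ?thesis by (intro orbitI(3)) (simp only: right_diff_distrib)
qed (simp_all add: orbitI unit_mult orbit_tail.scale assms(1))

text \<open>\<open>a\<close> is an involution up to the scalar \<open>t\<close>: after
  \<open>rot\<close> or \<open>rot_inv\<close>, a flip undoes the last \<open>a\<close> and leaves a
  rotation of \<open>t (x, y)\<close>.\<close>

lemma orbit_tail_flip: "orbit_tail x y \<Longrightarrow> orbit y (indet * x)"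
proof (induction rule: orbit_tail.induct)
  case (base x)
  then show ?case by (intro orbitI(6) unit_mult indet_unit)
next
  case (rot x y)
  then have "orbit_tail (indet * x) (indet * y)" by (intro orbit_tail.scale indet_unit)
  then show ?case by (intro orbitI(2)) (simp add: right_diff_distrib)
next
  case (rot_inv x y)
  then have "orbit_tail (indet * x) (indet * y)" by (intro orbit_tail.scale indet_unit)
  then show ?case by (intro orbitI(3)) (simp add: right_diff_distrib)
next
  case (scale c x y)
  then have "orbit (c * y) (c * (indet * x))" by (intro orbit_scale)
  then show ?case by (simp only: mult.left_commute)
qed

lemma orbit_flip:
  assumes "orbit x y"
  shows "orbit y (indet * x)"
  using assms
proof (cases rule: orbit_cases)
  case 5
  then show ?thesis using orbit_tail.rot by (intro orbitI(1)) fastforce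
next
  case 6
  then show ?thesis using orbit_tail.rot_inv by (intro orbitI(1)) fastforce
qed (simp_all add: orbitI unit_mult indet_unit orbit_tail.base orbit_tail_flip)

lemma orbit_tail_uminus: "orbit_tail x y \<Longrightarrow> orbit_tail (- x) (- y)"
  using orbit_tail.scale[of "- 1" x y] by simp

lemma orbit_rot: "orbit x y \<Longrightarrow> orbit y (y - x)"
  by (erule orbit_cases) (use orbit_tail_uminus[of "x - y" x] in \<open>auto intro: orbitI\<close>)

lemma orbit_rot_inv: "orbit x y \<Longrightarrow> orbit (x - y) x"
  by (erule orbit_cases) (use orbit_tail_uminus[of y "y - x"] in \<open>auto intro: orbitI\<close>)

text \<open>These are the images of \<open>(x, y)\<close> under sigma1, its inverse, sigma2 and its
  inverse. Each combines a flip with a rotation, up to a unit.\<close>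

lemma orbit_generators:
  assumes "orbit x y"
  shows "orbit (y - indet * x) y"
    and "orbit (Poly_Mapping.single (- 1) 1 * (y - x)) y"
    and "orbit x (indet * (x - y))"
    and "orbit x (x - Poly_Mapping.single (- 1) 1 * y)"
proof -
  let ?V = "Poly_Mapping.single (- 1) 1 :: laurent"
  have V: "?V * (indet * z) = z" for z
    by (metis indet_inverse(2) mult.assoc mult_1)
  show "orbit (y - indet * x) y" using assms by (intro orbit_rot_inv orbit_flip)
  show "orbit x (indet * (x - y))" using assms by (intro orbit_rot_inv orbit_flip)
  have "orbit (?V * (y - x)) (?V * (indet * y))"
    using assms by (intro orbit_scale orbit_flip orbit_rot indet_unit)
  then show "orbit (?V * (y - x)) y" by (simp only: V)
  have "orbit (?V * (indet * x)) (?V * (indet * x - y))"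
    using assms by (intro orbit_scale orbit_flip orbit_rot indet_unit)
  then show "orbit x (x - ?V * y)" by (simp only: V right_diff_distrib)
qed

section \<open>Orbits under the Burau matrices\<close>

definition burau_generator_inv :: "generator \<Rightarrow> laurent ^ 2 ^ 2" where
  "burau_generator_inv s = inv\<^bsub>GL2\<^esub> (burau_generator s)"

lemma GL2_inv_eq: "A ** B = mat 1 \<Longrightarrow> B ** A = mat 1 \<Longrightarrow> inv\<^bsub>GL2\<^esub> A = B"
  by (rule group.inv_equality[OF group_GL2]) (auto simp: invertible_def)

lemma burau_generator_inv:
  "burau_generator_inv Sigma1 = vector [vector [- Poly_Mapping.single (- 1) 1, Poly_Mapping.single (- 1) 1], vector [0, 1]]"
  "burau_generator_inv Sigma2 = vector [vector [1, 0], vector [1, - Poly_Mapping.single (- 1) 1]]"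
  unfolding burau_generator_inv_def
  by (rule GL2_inv_eq; simp add: vec_eq_iff forall_2 matrix_matrix_mult_def sum_2 mat_def indet_inverse)+

lemma burau_induct [case_names one gen gen_inv]:
  assumes "P (mat 1)"
    and "\<And>s A. P A \<Longrightarrow> P (burau_generator s ** A)"
    and "\<And>s A. P A \<Longrightarrow> P (burau_generator_inv s ** A)"
  shows "P (burau x)"
proof -
  have "P (word_value GL2 burau_generator w)" for w
    by (induction w)
       (use assms in \<open>auto simp del: burau_generator.simps simp flip: burau_generator_inv_def\<close>)
  then show ?thesis by transfer
qed

lemma orbit_burau: "orbit (burau x $ 1 $ 1) (burau x $ 2 $ 1)"
proof (induction x rule: burau_induct)
  case one
  show ?case by (simp add: mat_def orbit_def)
next
  case (gen s A)
  then show ?case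
    using orbit_generators(1,3)[of "A $ 1 $ 1" "A $ 2 $ 1"]
    by (cases s) (simp_all add: matrix_matrix_mult_def sum_2 algebra_simps)
next
  case (gen_inv s A)
  then show ?case
    using orbit_generators(2,4)[of "A $ 1 $ 1" "A $ 2 $ 1"]
    by (cases s) (simp_all add: burau_generator_inv matrix_matrix_mult_def sum_2 algebra_simps)
qed

section \<open>Ping-pong at real parameters\<close>

lemma laurent_eval_diff [simp]: "laurent_eval t (p - q) = laurent_eval t p - laurent_eval t q"
  using laurent_eval_add[of t p "- q"] by simp

lemma laurent_eval_unit:
  assumes "t \<noteq> 0" "p dvd 1"
  shows "laurent_eval t p \<noteq> 0"
proof -
  from assms(2) obtain q where "1 = p * q" by (auto simp: dvd_def)
  then have "laurent_eval t p * laurent_eval t q = 1"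
    using assms(1) by (metis laurent_eval_mult laurent_eval_one)
  then show ?thesis by auto
qed

text \<open>For T > 0 this is the ping-pong set 0 < |x / y| < 1 / sqrt T, bounded by the fixed
  points of z -> 1 / (T z).\<close>

definition steep :: "real \<Rightarrow> real \<Rightarrow> real \<Rightarrow> bool" where
  "steep T x y \<longleftrightarrow> x \<noteq> 0 \<and> T * x\<^sup>2 < y\<^sup>2"

lemma steep_scale: "c \<noteq> 0 \<Longrightarrow> steep T (c * x) (c * y) \<longleftrightarrow> steep T x y"
  by (simp add: steep_def power_mult_distrib mult.left_commute)

text \<open>The threshold, the square of the golden ratio, is the larger root of (T - 1)^2 -
  T.\<close>

lemma golden_square_le:
  assumes "(3 + sqrt 5) / 2 \<le> T"
  shows "1 < T" "sqrt T + 1 \<le> T"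
proof -
  have "sqrt 5 \<ge> (2 :: real)" by (rule real_le_rsqrt) simp
  moreover have "3 + sqrt 5 \<le> 2 * T" using assms by (simp add: field_simps)
  ultimately show "1 < T" by linarith
  have "(sqrt 5 / 2)\<^sup>2 \<le> (T - 3 / 2)\<^sup>2" using assms by (intro power_mono) (auto simp: field_simps)
  then have *: "T \<le> (T - 1)\<^sup>2" by (simp add: power2_eq_square algebra_simps)
  have "sqrt T \<le> T - 1" using * \<open>1 < T\<close> by (intro real_le_lsqrt) simp_all
  then show "sqrt T + 1 \<le> T" by simp
qed

lemma steep_iff:
  assumes "T > 0"
  shows "steep T x y \<longleftrightarrow> x \<noteq> 0 \<and> sqrt T * \<bar>x\<bar> < \<bar>y\<bar>"
proof -
  have "T * x\<^sup>2 = (sqrt T * \<bar>x\<bar>)\<^sup>2" using assms by (simp add: power_mult_distrib)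
  moreover have "sqrt T * \<bar>x\<bar> \<ge> 0" using assms by simp
  ultimately have "T * x\<^sup>2 < y\<^sup>2 \<longleftrightarrow> sqrt T * \<bar>x\<bar> < \<bar>y\<bar>"
    using power2_less_imp_less[of "sqrt T * \<bar>x\<bar>" "\<bar>y\<bar>"]
      power_strict_mono[of "sqrt T * \<bar>x\<bar>" "\<bar>y\<bar>" 2] by auto
  then show ?thesis by (simp add: steep_def)
qed

text \<open>Both rotations move the set into |z| > 1 / s, where s = sqrt T, since |1 - z| < 1 + 1 /
  s <= s and |1 / z - 1| > s - 1 >= 1 / s. Then z -> 1 / (T z) brings it back.\<close>

lemma steep_steps:
  assumes T: "(3 + sqrt 5) / 2 \<le> T" and "steep T x y"
  shows "steep T (y - x) (T * y)" "steep T x (T * (x - y))"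
proof -
  define s where "s = sqrt T"
  have s: "s > 0" "s * s = T" "s + 1 \<le> s * s" "s > 1" "T > 0"
    using golden_square_le[OF T] by (auto simp: s_def)
  have xy: "x \<noteq> 0" "s * \<bar>x\<bar> < \<bar>y\<bar>" using assms(2) s by (auto simp: steep_iff s_def)
  have lt: "\<bar>x\<bar> < \<bar>y\<bar>" using xy s mult_right_mono[of 1 s "\<bar>x\<bar>"] by linarith
  have "s * \<bar>y - x\<bar> \<le> s * (\<bar>y\<bar> + \<bar>x\<bar>)" using s by (intro mult_left_mono) auto
  also have "\<dots> < s * \<bar>y\<bar> + \<bar>y\<bar>" using xy by (simp add: distrib_left)
  also have "\<dots> = (s + 1) * \<bar>y\<bar>" by (simp add: algebra_simps)
  also have "\<dots> \<le> T * \<bar>y\<bar>" using s by (intro mult_right_mono) auto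
  finally show "steep T (y - x) (T * y)"
    using s lt by (auto simp: steep_iff abs_mult simp flip: s_def)
  have sx: "s * s * \<bar>x\<bar> \<le> s * \<bar>y\<bar>"
    unfolding mult.assoc using xy s by (intro mult_left_mono) auto
  have "s * \<bar>x\<bar> < \<bar>y\<bar>" by (fact xy)
  also have "\<bar>y\<bar> \<le> (s * s - s) * \<bar>y\<bar>" using s mult_right_mono[of 1 "s * s - s" "\<bar>y\<bar>"] by simp
  also have "\<dots> = s * s * \<bar>y\<bar> - s * \<bar>y\<bar>" by (simp add: algebra_simps)
  also have "\<dots> \<le> s * s * \<bar>y\<bar> - s * s * \<bar>x\<bar>"
    using sx by simp
  also have "\<dots> = T * (\<bar>y\<bar> - \<bar>x\<bar>)" using s by (simp add: algebra_simps)
  also have "\<dots> \<le> T * \<bar>x - y\<bar>" using s by (intro mult_left_mono) auto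
  finally show "steep T x (T * (x - y))"
    using s xy by (auto simp: steep_iff abs_mult simp flip: s_def)
qed

lemma orbit_tail_steep:
  assumes T: "(3 + sqrt 5) / 2 \<le> t" and "orbit_tail x y"
  shows "steep t (laurent_eval t x) (laurent_eval t y)"
  using assms(2)
proof (induction rule: orbit_tail.induct)
  case (base x)
  then have "laurent_eval t x \<noteq> 0" using golden_square_le(1)[OF T] by (simp add: laurent_eval_unit)
  then show ?case using golden_square_le(1)[OF T]
    by (simp add: steep_def power_mult_distrib power2_eq_square[of t])
next
  case (scale c x y)
  then show ?case
    using golden_square_le(1)[OF T] laurent_eval_unit[of t c] by (simp add: steep_scale)
qed (use steep_steps[OF T] golden_square_le(1)[OF T] in simp_all)

text \<open>For small \<open>t\<close> the coordinate change \<open>z \<mapsto> 1 / z\<close> replaces \<open>t\<close> by \<open>1 / t\<close> and \<open>b\<close> by \<open>b\<inverse>\<close>.\<close>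

lemma orbit_tail_steep_inverse:
  assumes "t > 0" and T: "(3 + sqrt 5) / 2 \<le> inverse t" and "orbit_tail x y"
  shows "steep (inverse t) (laurent_eval t y) (laurent_eval t x)"
  using assms(3)
proof (induction rule: orbit_tail.induct)
  case (base x)
  then have "laurent_eval t x \<noteq> 0" using \<open>t > 0\<close> by (simp add: laurent_eval_unit)
  moreover have "t < 1" using golden_square_le(1)[OF T] \<open>t > 0\<close> by (simp add: one_less_inverse_iff)
  ultimately show ?case using \<open>t > 0\<close>
    by (simp add: steep_def power_mult_distrib power2_eq_square[of t] mult.assoc[symmetric])
next
  case (scale c x y)
  then show ?case
    using \<open>t > 0\<close> laurent_eval_unit[of t c] by (simp add: steep_scale)
next
  case (rot x y)
  let ?x = "laurent_eval t x" and ?y = "laurent_eval t y"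
  have "steep (inverse t) (t * ?y) (t * (inverse t * (?y - ?x)))"
    using \<open>t > 0\<close> steep_steps(2)[OF T rot.IH] by (subst steep_scale) auto
  then show ?case using \<open>t > 0\<close> by (simp flip: mult.assoc)
next
  case (rot_inv x y)
  let ?x = "laurent_eval t x" and ?y = "laurent_eval t y"
  have "steep (inverse t) (t * (?x - ?y)) (t * (inverse t * ?x))"
    using \<open>t > 0\<close> steep_steps(1)[OF T rot_inv.IH] by (subst steep_scale) auto
  then show ?case using \<open>t > 0\<close> by (simp flip: mult.assoc)
qed

text \<open>The point avoids 0, infinity and 1. As \<open>b\<close> permutes these, its rotations
  avoid infinity too.\<close>

lemma steep_nonzero:
  assumes "T > 1" "steep T x y"
  shows "x \<noteq> 0" "y \<noteq> 0" "x \<noteq> y"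
proof -
  show "x \<noteq> 0" using assms by (simp add: steep_def)
  then have "x\<^sup>2 < T * x\<^sup>2" using assms by simp
  also have "\<dots> < y\<^sup>2" using assms by (simp add: steep_def)
  finally have "x\<^sup>2 < y\<^sup>2" .
  then show "y \<noteq> 0" "x \<noteq> y" by auto
qed

lemma orbit_root_bounds:
  assumes "t > 0" "orbit x y" "y \<noteq> 0" "laurent_eval t y = 0"
  shows "(3 - sqrt 5) / 2 < t" "t < (3 + sqrt 5) / 2"
proof -
  \<comment> \<open>A nonzero \<open>y\<close> with a root is not a unit, which rules out the
    initial triple.\<close>
  have tail: "orbit_tail x y \<or> orbit_tail (x - y) x \<or> orbit_tail y (y - x)"
    using assms laurent_eval_unit[of t y] by (auto simp: orbit_def)
  show "t < (3 + sqrt 5) / 2"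
  proof (rule ccontr)
    assume "\<not> ?thesis"
    then have T: "(3 + sqrt 5) / 2 \<le> t" by simp
    show False
      using tail orbit_tail_steep[OF T] steep_nonzero[OF golden_square_le(1)[OF T]] assms(4)
      by fastforce
  qed
  show "(3 - sqrt 5) / 2 < t"
  proof (rule ccontr)
    assume "\<not> ?thesis"
    then have "t \<le> (3 - sqrt 5) / 2" by simp
    then have "inverse ((3 - sqrt 5) / 2) \<le> inverse t" using assms(1) by (intro le_imp_inverse_le)
    moreover have "inverse ((3 - sqrt 5) / 2) = (3 + sqrt 5) / 2"
      by (rule inverse_unique) (simp add: algebra_simps)
    ultimately have T: "(3 + sqrt 5) / 2 \<le> inverse t" by simp
    show False
      using tail orbit_tail_steep_inverse[OF assms(1) T] steep_nonzero[OF golden_square_le(1)[OF T]] assms(4)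
      by fastforce
  qed
qed

section \<open>The invariant sesquilinear form\<close>

definition laurent_bar :: "laurent \<Rightarrow> laurent" where
  "laurent_bar = Poly_Mapping.map_key uminus"

lemma laurent_bar_single: "laurent_bar (Poly_Mapping.single k c) = Poly_Mapping.single (- k) c"
  using map_key_single[of uminus "- k" c] by (simp add: laurent_bar_def)

lemma laurent_bar_zero [simp]: "laurent_bar 0 = 0"
  by (simp add: laurent_bar_def)

lemma laurent_bar_one [simp]: "laurent_bar 1 = 1"
  using laurent_bar_single[of 0 1] by simp

lemma laurent_bar_add [simp]: "laurent_bar (p + q) = laurent_bar p + laurent_bar q"
  by (simp add: laurent_bar_def map_key_plus)

lemma laurent_bar_minus [simp]: "laurent_bar (- p) = - laurent_bar p"
  using laurent_bar_add[of p "- p"] by (simp add: eq_neg_iff_add_eq_0 add.commute)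

lemma laurent_bar_mult [simp]: "laurent_bar (p * q) = laurent_bar p * laurent_bar q"
proof (induction p rule: laurent_induct)
  case (single k c)
  show ?case
  proof (induction q rule: laurent_induct)
    case (single l d)
    then show ?case by (simp add: mult_single laurent_bar_single add.commute)
  qed (simp_all add: distrib_left)
qed (simp_all add: distrib_right)

lemma laurent_eval_bar: "laurent_eval t (laurent_bar p) = laurent_eval (inverse t) p"
  by (induction p rule: laurent_induct)
     (simp_all add: laurent_bar_single laurent_eval_single power_int_minus power_int_inverse)

lemma laurent_bar_bar [simp]: "laurent_bar (laurent_bar p) = p"
  by (induction p rule: laurent_induct) (simp_all add: laurent_bar_single)

lemma laurent_bar_indet [simp]:
  "laurent_bar indet = Poly_Mapping.single (- 1) 1"
  "laurent_bar (Poly_Mapping.single (- 1) 1) = indet"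
  by (simp_all add: indet_def laurent_bar_single)

text \<open>Conjugate transposition multiplies this matrix by the inverse of \<open>t\<close>; a
  truly Hermitian version would need a square root of \<open>t\<close>.\<close>

definition squier_form :: "laurent ^ 2 ^ 2" where
  "squier_form = vector [vector [1 + indet, - 1], vector [- indet, 1 + indet]]"

definition unitary :: "laurent ^ 2 ^ 2 \<Rightarrow> bool" where
  "unitary A \<longleftrightarrow> transpose (map_matrix laurent_bar A) ** squier_form ** A = squier_form"

lemma unitary_mult:
  assumes "unitary A" "unitary B"
  shows "unitary (A ** B)"
proof -
  have "map_matrix laurent_bar (A ** B) = map_matrix laurent_bar A ** map_matrix laurent_bar B"
    by (simp add: vec_eq_iff matrix_matrix_mult_def sum_2)
  then have "transpose (map_matrix laurent_bar (A ** B)) ** squier_form ** (A ** B) =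
      transpose (map_matrix laurent_bar B) **
        (transpose (map_matrix laurent_bar A) ** squier_form ** A) ** B"
    by (simp add: matrix_transpose_mul matrix_mul_assoc)
  then show ?thesis using assms by (simp add: unitary_def)
qed

lemma unitary_generator: "unitary (burau_generator s)" "unitary (burau_generator_inv s)"
proof -
  have V: "indet * (Poly_Mapping.single (- 1) 1 * z) = z" "Poly_Mapping.single (- 1) 1 * (indet * z) = z" for z
    by (simp_all add: indet_inverse flip: mult.assoc)
  show "unitary (burau_generator s)" "unitary (burau_generator_inv s)"
    unfolding unitary_def
    by (cases s; simp add: squier_form_def burau_generator_inv transpose_def vec_eq_iff forall_2
        matrix_matrix_mult_def sum_2 algebra_simps indet_inverse V)+
qed

lemma unitary_burau: "unitary (burau x)"
proof (induction x rule: burau_induct)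
  case one
  have "map_matrix laurent_bar (mat 1 :: laurent ^ 2 ^ 2) = mat 1"
    by (simp add: vec_eq_iff mat_def)
  then show ?case by (simp add: unitary_def transpose_mat)
qed (simp_all add: unitary_mult unitary_generator)

section \<open>Commuting unipotents\<close>

text \<open>
  With \<open>U = (p, q; r, v)\<close> a conjugate of \<open>S = \<rho>(\<sigma>\<^sub>1)\<close> and \<open>u = t\<inverse>\<close>, the equations \<open>e11\<close> and \<open>e21\<close> are
  entries of the relation that \<open>U S\<inverse>\<close> and \<open>S\<inverse> U\<close> commute. The conclusion says that \<open>U\<close> fixes \<open>(1, 1 + t)\<close>.
\<close>

lemma commuting_relation_off_diagonal:
  fixes t u p q r v :: "'a :: idom"
  assumes "t * u = 1" "t \<noteq> 1" and tr: "p + v = 1 - t" and "r \<noteq> 0"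
    and e11: "r * (u * p + q) + u * u * r * (v - q) = 0"
    and e21: "- u * r * (u * r - u * p) + (u * r + v) * r + r * u * p + v * u * r = 0"
  shows "p + (1 + t) * q = 1" "r + (1 + t) * v = 1 + t"
proof -
  have v: "v = 1 - t - p" using tr by (simp add: algebra_simps)
  have "r * (t - 1) * (p + (1 + t) * q - 1) = 0"
    using e11 \<open>t * u = 1\<close> unfolding v by algebra
  then show "p + (1 + t) * q = 1" using assms by auto
  have "r * (t - 1) * (r + (1 + t) * v - (1 + t)) = 0"
    using e21 \<open>t * u = 1\<close> tr by algebra
  then show "r + (1 + t) * v = 1 + t" using assms by auto
qed

lemma laurent_neqI: "laurent_eval t p \<noteq> laurent_eval t q \<Longrightarrow> p \<noteq> q"
  by auto

text \<open>\<open>(1, 0)\<close> spans the orthogonal complement of \<open>(1, 1 + t)\<close>, so fixing the line of the latter means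
  fixing the line of the former.\<close>

lemma unitary_fixed_line:
  assumes "unitary M" and det: "M $ 1 $ 1 * M $ 2 $ 2 - M $ 1 $ 2 * M $ 2 $ 1 \<noteq> 0"
    and line: "M $ 2 $ 1 + (1 + indet) * M $ 2 $ 2 = (1 + indet) * (M $ 1 $ 1 + (1 + indet) * M $ 1 $ 2)"
  shows "M $ 2 $ 1 = 0"
proof -
  define a b c d where abcd: "a = M $ 1 $ 1" "b = M $ 1 $ 2" "c = M $ 2 $ 1" "d = M $ 2 $ 2"
  define a' b' c' d' where abcd': "a' = laurent_bar a" "b' = laurent_bar b"
    "c' = laurent_bar c" "d' = laurent_bar d"
  define t u where tu: "t = indet" "u = (Poly_Mapping.single (- 1) 1 :: laurent)"
  define m where "m = a + (1 + t) * b"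
  have tu1: "t * u = 1" by (simp add: tu indet_inverse)
  have f11: "(a' * (1 + t) + c' * (- t)) * a + (a' * (- 1) + c' * (1 + t)) * c = 1 + t"
    and f21: "(b' * (1 + t) + d' * (- t)) * a + (b' * (- 1) + d' * (1 + t)) * c = - t"
    using assms(1) unfolding unitary_def abcd abcd' tu
    by (simp_all add: squier_form_def vec_eq_iff forall_2 matrix_matrix_mult_def sum_2 transpose_def)
  have cd: "c + (1 + t) * d = (1 + t) * m" using line by (simp add: abcd tu m_def)
  have "laurent_bar (c + (1 + t) * d) = laurent_bar ((1 + t) * m)" using cd by simp
  then have "c' + (1 + u) * d' = (1 + u) * (a' + (1 + u) * b')"
    by (simp add: m_def abcd' tu)
  \<comment> \<open>By invariance, the images \<open>m (1, 1 + t)\<close> and \<open>(a, c)\<close>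
    of the orthogonal vectors \<open>(1, 1 + t)\<close> and \<open>(1, 0)\<close> are
    orthogonal.\<close>
  then have "(a' + (1 + u) * b') * c * (t + 1 + u) = 0"
    using f11 f21 tu1 by algebra
  moreover have "a' + (1 + u) * b' = laurent_bar m" by (simp add: m_def abcd' tu)
  moreover have "t + 1 + u \<noteq> 0"
    by (rule laurent_neqI[of 1]) (simp add: tu laurent_eval_single)
  moreover have "laurent_bar m \<noteq> 0"
  proof
    assume "laurent_bar m = 0"
    then have "m = 0" by (metis laurent_bar_bar laurent_bar_zero)
    then have "a * d - b * c = 0" using cd unfolding m_def by algebra
    then show False using det by (simp add: abcd)
  qed
  ultimately show ?thesis by (simp add: abcd)
qed

text \<open>Comparing the form on \<open>(1, 0)\<close> and on its image gives \<open>eq\<close>. At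
  t = -1, which equals its inverse, \<open>eq\<close> makes a real square equal to -1.\<close>

lemma unitary_swapped_line:
  assumes "unitary M" and c: "M $ 2 $ 1 = (1 + indet) * M $ 1 $ 1"
  shows False
proof -
  define a where "a = M $ 1 $ 1"
  define a' where "a' = laurent_bar a"
  define t u where tu: "t = indet" "u = (Poly_Mapping.single (- 1) 1 :: laurent)"
  have tu1: "t * u = 1" by (simp add: tu indet_inverse)
  have "laurent_bar (M $ 2 $ 1) = (1 + u) * a'" by (simp add: c a_def a'_def tu)
  then have "(a' * (1 + t) + (1 + u) * a' * (- t)) * a + (a' * (- 1) + (1 + u) * a' * (1 + t)) * ((1 + t) * a) = 1 + t"
    using assms(1) unfolding unitary_def
    by (simp add: squier_form_def vec_eq_iff forall_2 matrix_matrix_mult_def sum_2 transpose_def c tu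
        flip: a_def a'_def)
  then have "(1 + t) * (a' * a * (1 + t + t * t) - t) = 0"
    using tu1 by algebra
  moreover have "1 + t \<noteq> 0" by (rule laurent_neqI[of 1]) (simp add: tu)
  ultimately have eq: "a' * a * (1 + t + t * t) = t" by simp
  have "laurent_eval (- 1) (a' * a * (1 + t + t * t)) = (laurent_eval (- 1) a)\<^sup>2"
    by (simp add: tu a'_def laurent_eval_bar power2_eq_square)
  moreover have "laurent_eval (- 1) (a' * a * (1 + t + t * t)) = - 1"
    unfolding eq by (simp add: tu)
  ultimately show False using zero_le_power2[of "laurent_eval (- 1) a"] by linarith
qed

text \<open>If \<open>r\<close> is nonzero, \<open>U\<close> fixes \<open>(1, 1 + t)\<close>, so
  \<open>M\<close> maps it into the 1-eigenline of sigma1, which it spans. If \<open>r = 0\<close>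
  but \<open>c\<close> is not, then \<open>p = 1\<close> and \<open>M\<close> maps
  \<open>(1, 0)\<close> into that line.\<close>

lemma commuting_relation_imp_triangular:
  fixes M U :: "laurent ^ 2 ^ 2"
  defines "T \<equiv> burau_generator_inv Sigma1"
  assumes "unitary M" and det: "M $ 1 $ 1 * M $ 2 $ 2 - M $ 1 $ 2 * M $ 2 $ 1 \<noteq> 0"
    and conj: "burau_generator Sigma1 ** M = M ** U"
    and comm: "(U ** T) ** (T ** U) = (T ** U) ** (U ** T)"
  shows "M $ 2 $ 1 = 0"
proof -
  define a b c d where abcd: "a = M $ 1 $ 1" "b = M $ 1 $ 2" "c = M $ 2 $ 1" "d = M $ 2 $ 2"
  define p q r v where pqrv: "p = U $ 1 $ 1" "q = U $ 1 $ 2" "r = U $ 2 $ 1" "v = U $ 2 $ 2"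
  define t u where tu: "t = indet" "u = (Poly_Mapping.single (- 1) 1 :: laurent)"
  have tu1: "t * u = 1" by (simp add: tu indet_inverse)
  have t1: "t \<noteq> 1" by (rule laurent_neqI[of 2]) (simp add: tu)
  have e: "- t * a + c = a * p + b * r" "- t * b + d = a * q + b * v"
    "c = c * p + d * r" "d = c * q + d * v"
    using conj unfolding abcd pqrv tu
    by (simp_all add: vec_eq_iff forall_2 matrix_matrix_mult_def sum_2)
  have e11: "(p * - u) * (- u * p + u * r) + (p * u + q) * r =
        (- u * p + u * r) * (p * - u) + (- u * q + u * v) * (r * - u)"
    and e21: "(r * - u) * (- u * p + u * r) + (r * u + v) * r =
        r * (p * - u) + v * (r * - u)"
    using comm unfolding pqrv tu T_def
    by (simp_all add: burau_generator_inv vec_eq_iff forall_2 matrix_matrix_mult_def sum_2)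
  have "(a * d - b * c) * (p + v - (1 - t)) = 0" using e by algebra
  then have tr: "p + v = 1 - t" using det by (simp add: abcd)
  show ?thesis
  proof (cases "r = 0")
    case False
    have "r * (u * p + q) + u * u * r * (v - q) = 0"
      and "- u * r * (u * r - u * p) + (u * r + v) * r + r * u * p + v * u * r = 0"
      using e11 e21 by algebra+
    note commuting_relation_off_diagonal[OF tu1 t1 tr False this]
    then have "c + (1 + t) * d = (1 + t) * (a + (1 + t) * b)" using e by algebra
    then show ?thesis
      using unitary_fixed_line[OF assms(2) det] by (simp add: abcd tu)
  next
    case r: True
    show ?thesis
    proof (rule ccontr)
      assume "M $ 2 $ 1 \<noteq> 0"
      then have p: "p = 1" using e(3) r by (simp add: abcd)
      then have "c = (1 + t) * a" using e(1) r by algebra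
      then show False using unitary_swapped_line[OF assms(2)] by (simp add: abcd tu)
    qed
  qed
qed

section \<open>From a triangular specialization to unfaithfulness\<close>

lemma triangular_relation:
  fixes A H :: "real ^ 2 ^ 2" and t :: real
  defines "T \<equiv> map_matrix (laurent_eval t) (burau_generator_inv Sigma1)"
  assumes "t \<noteq> 0" "invertible A" "A $ 2 $ 1 = 0"
    and conj: "map_matrix (laurent_eval t) (burau_generator Sigma1) ** A = A ** H"
  shows "(H ** T) ** (T ** H) = (T ** H) ** (H ** T)"
proof -
  have "det A \<noteq> 0" using assms(3) by (simp add: invertible_det_nz)
  then have ad: "A $ 1 $ 1 \<noteq> 0" "A $ 2 $ 2 \<noteq> 0" using assms(4) by (auto simp: det_2)
  have e: "- t * A $ 1 $ 1 = A $ 1 $ 1 * H $ 1 $ 1 + A $ 1 $ 2 * H $ 2 $ 1"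
      "0 = A $ 2 $ 2 * H $ 2 $ 1" "A $ 2 $ 2 = A $ 2 $ 2 * H $ 2 $ 2"
    using conj assms(4) by (simp_all add: vec_eq_iff forall_2 matrix_matrix_mult_def sum_2)
  then have "H $ 2 $ 1 = 0" "H $ 2 $ 2 = 1" using ad by simp_all
  moreover from this have "A $ 1 $ 1 * (H $ 1 $ 1 + t) = 0"
    using e(1) by (simp add: algebra_simps)
  then have "H $ 1 $ 1 = - t" using ad by (simp add: eq_neg_iff_add_eq_0)
  ultimately show ?thesis
    using assms(2)
    by (simp add: T_def burau_generator_inv vec_eq_iff forall_2 matrix_matrix_mult_def sum_2
        laurent_eval_single power_int_minus field_simps)
qed

lemma group_hom_burau: "group_hom B3 GL2 burau"
  by (simp add: group_hom_def group_hom_axioms_def group_B3 group_GL2 burau_hom)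

lemma burau_mult: "burau (braid_mult x y) = burau x ** burau y"
  using hom_mult[OF burau_hom, of x y] by simp

lemma burau_specialization_mult:
  "t \<noteq> 0 \<Longrightarrow> burau_specialization t (braid_mult x y) =
     burau_specialization t x ** burau_specialization t y"
  using hom_mult[OF burau_specialization_hom, of t x y] by simp

lemma burau_entries_det:
  "burau x $ 1 $ 1 * burau x $ 2 $ 2 - burau x $ 1 $ 2 * burau x $ 2 $ 1 \<noteq> 0"
proof -
  have "invertible (burau x)" using burau_hom by (auto simp: hom_def)
  then obtain B where "burau x ** B = mat 1" by (auto simp: invertible_def)
  then have "det (burau x) * det B = 1" by (metis det_mul det_I)
  then show ?thesis by (auto simp: det_2)
qed

lemma unfaithful_if_triangular:
  assumes "t \<noteq> 0" "burau_specialization t g $ 2 $ 1 = 0" "burau g $ 2 $ 1 \<noteq> 0"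
  shows "unfaithful_specialization t"
  unfolding unfaithful_specialization_def
proof
  assume inj: "inj_on (burau_specialization t) (carrier B3)"
  define s i h where "s = braid_gen Sigma1" "i = inv\<^bsub>B3\<^esub> s" "h = inv\<^bsub>B3\<^esub> g \<otimes>\<^bsub>B3\<^esub> (s \<otimes>\<^bsub>B3\<^esub> g)"
  note sih = this
  interpret B3: group B3 by (rule group_B3)
  have bs: "burau s = burau_generator Sigma1" by (simp add: sih burau_braid_gen del: burau_generator.simps)
  have bi: "burau i = burau_generator_inv Sigma1"
    using group_hom.hom_inv[OF group_hom_burau, of s] by (simp add: sih(2) bs burau_generator_inv_def del: burau_generator.simps)
  have "g \<otimes>\<^bsub>B3\<^esub> (inv\<^bsub>B3\<^esub> g \<otimes>\<^bsub>B3\<^esub> (s \<otimes>\<^bsub>B3\<^esub> g)) = s \<otimes>\<^bsub>B3\<^esub> g"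
    by (subst B3.m_assoc[symmetric]) (simp_all del: B3_simps(2,3) add: B3.r_inv)
  then have gh: "braid_mult s g = braid_mult g h" by (simp add: sih)
  let ?\<phi> = "burau_specialization t"
  have "invertible (?\<phi> g)"
    using burau_specialization_hom[OF assms(1)] by (auto simp: hom_def)
  moreover have "?\<phi> s ** ?\<phi> g = ?\<phi> g ** ?\<phi> h"
    using arg_cong[OF gh, of ?\<phi>] assms(1) by (simp add: burau_specialization_mult)
  ultimately have "(?\<phi> h ** ?\<phi> i) ** (?\<phi> i ** ?\<phi> h) = (?\<phi> i ** ?\<phi> h) ** (?\<phi> h ** ?\<phi> i)"
    using triangular_relation[OF assms(1) _ assms(2)]
    by (simp add: burau_specialization_def bs bi del: burau_generator.simps)
  then have "?\<phi> (braid_mult (braid_mult h i) (braid_mult i h)) =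
      ?\<phi> (braid_mult (braid_mult i h) (braid_mult h i))"
    using assms(1) by (simp add: burau_specialization_mult)
  then have "braid_mult (braid_mult h i) (braid_mult i h) = braid_mult (braid_mult i h) (braid_mult h i)"
    using inj by (simp add: inj_on_def)
  then have "(burau h ** burau i) ** (burau i ** burau h) = (burau i ** burau h) ** (burau h ** burau i)"
    by (metis burau_mult)
  moreover have "burau_generator Sigma1 ** burau g = burau g ** burau h"
    using gh by (metis bs burau_mult)
  ultimately have "burau g $ 2 $ 1 = 0"
    using commuting_relation_imp_triangular[OF unitary_burau burau_entries_det] by (simp only: bi)
  with assms(3) show False by simp
qed

theorem corollary4p2:
  fixes M :: "laurent ^ 2 ^ 2" and \<alpha> :: real
  assumes "M \<in> burau ` (carrier B3 - generate B3 {braid_gen Sigma1})"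
    and "\<alpha> > 0"
    and "laurent_root \<alpha> (M $ 2 $ 1)"
  shows "\<alpha> \<in> {(3 - sqrt 5) / 2 <..< (3 + sqrt 5) / 2} \<and> unfaithful_specialization \<alpha>"
proof -
  obtain g where g: "M = burau g" using assms(1) by blast
  have root: "M $ 2 $ 1 \<noteq> 0" "laurent_eval \<alpha> (M $ 2 $ 1) = 0"
    using assms(3) by (auto simp: laurent_root_def)
  have "unfaithful_specialization \<alpha>"
    using unfaithful_if_triangular[of \<alpha> g] root assms(2)
    by (simp add: g burau_specialization_def)
  moreover have "\<alpha> \<in> {(3 - sqrt 5) / 2 <..< (3 + sqrt 5) / 2}"
    using orbit_root_bounds[OF assms(2) orbit_burau[of g]] root by (simp add: g)
  ultimately show ?thesis by blast
qed

end
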